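(* Any parameterized family of Lorentz-invariant six-dimensional chiral two-form theories satisfies, locally and away from singular points, a generalized $T\overline T$-like flow. Precisely: let $\mathcal H(s,p;\lambda)$ be a smooth function on an open subset of $\{(s,p,\lambda): s>p>0,\ \lambda\in\mathbb R\}$ such that for every $\lambda$ $$\mathcal H_s^2+\frac{2s}{p}\mathcal H_s\mathcal H_p+\mathcal H_p^2=1 ,$$ and let $$\tau(s,p;\lambda)=6\mathcal H^2-2p^2-12p\mathcal H\mathcal H_p+8p^2\mathcal H_p^2+4s\mathcal H_s\left(4p\mathcal H_p-3\mathcal H\right)-4\left(p^2-3s^2\right)\mathcal H_s^2$$ (the scalar $T^{\mu\nu}T_{\mu\nu}$ of the energy-momentum tensor of the theory at parameter value $\lambda$). Then for every point $(s_0,p_0,\lambda_0)$ of the domain at which $(\tau_s,\tau_p)\neq(0,0)$ there are a neighbourhood of this point and a function $f$ of two variables such that, on this neighbourhood, $$\frac{\partial\mathcal H(s,p;\lambda)}{\partial\lambda}=f\left(\tau(s,p;\lambda),\lambda\right).$$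
   Context: Subscripts $s,p$ denote partial derivatives. The PDE on $\mathcal H$ is the condition for Lorentz (equivalently PST gauge) invariance of the six-dimensional chiral two-form theory with Hamiltonian density $\mathcal H(s,p)$. *)

theory Defs
  imports "HOL-Analysis.Analysis"
begin

text \<open>Continuous differentiability of order \<open>n\<close> on an open set, via iterated directional
  derivatives of the Frechet derivative. Only meant for open \<open>S\<close>.\<close>

fun Ck_on :: "nat \<Rightarrow> ('a::real_normed_vector \<Rightarrow> 'b::real_normed_vector) \<Rightarrow> 'a set \<Rightarrow> bool" where
  "Ck_on 0 f S \<longleftrightarrow> continuous_on S f"
| "Ck_on (Suc n) f S \<longleftrightarrow>
     (\<forall>x\<in>S. f differentiable (at x)) \<and> (\<forall>v. Ck_on n (\<lambda>x. frechet_derivative f (at x) v) S)"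

definition smooth_on :: "('a::real_normed_vector \<Rightarrow> 'b::real_normed_vector) \<Rightarrow> 'a set \<Rightarrow> bool" where
  "smooth_on f S \<longleftrightarrow> (\<forall>n. Ck_on n f S)"

text \<open>Functions of \<open>(s, p, \<lambda>)\<close> are functions on \<open>real \<times> real \<times> real\<close>; the partial derivatives below
  carry the name of the differentiated variable (\<open>dlam\<close> for \<open>\<lambda>\<close>).\<close>

definition ds :: "(real \<times> real \<times> real \<Rightarrow> real) \<Rightarrow> real \<times> real \<times> real \<Rightarrow> real" where
  "ds F = (\<lambda>(s, p, l). deriv (\<lambda>x. F (x, p, l)) s)"

definition dp :: "(real \<times> real \<times> real \<Rightarrow> real) \<Rightarrow> real \<times> real \<times> real \<Rightarrow> real" where
  "dp F = (\<lambda>(s, p, l). deriv (\<lambda>x. F (s, x, l)) p)"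

definition dlam :: "(real \<times> real \<times> real \<Rightarrow> real) \<Rightarrow> real \<times> real \<times> real \<Rightarrow> real" where
  "dlam F = (\<lambda>(s, p, l). deriv (\<lambda>x. F (s, p, x)) l)"

text \<open>The condition for Lorentz invariance of the chiral two-form theory with Hamiltonian density
  \<open>H(\<cdot>, \<cdot>, \<lambda>)\<close>, at every parameter value \<open>\<lambda>\<close>.\<close>

definition lorentz_invariant_on ::
    "(real \<times> real \<times> real \<Rightarrow> real) \<Rightarrow> (real \<times> real \<times> real) set \<Rightarrow> bool" where
  "lorentz_invariant_on H U \<longleftrightarrow>
     (\<forall>(s, p, l)\<in>U. (ds H (s, p, l))\<^sup>2 + 2 * s / p * ds H (s, p, l) * dp H (s, p, l)
        + (dp H (s, p, l))\<^sup>2 = 1)"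

text \<open>The scalar \<open>T\<^sup>\<mu>\<^sup>\<nu> T\<^sub>\<mu>\<^sub>\<nu>\<close> of the energy-momentum tensor.\<close>

definition tau :: "(real \<times> real \<times> real \<Rightarrow> real) \<Rightarrow> real \<times> real \<times> real \<Rightarrow> real" where
  "tau H = (\<lambda>(s, p, l).
     let h = H (s, p, l); hs = ds H (s, p, l); hp = dp H (s, p, l)
     in 6 * h\<^sup>2 - 2 * p\<^sup>2 - 12 * p * h * hp + 8 * p\<^sup>2 * hp\<^sup>2
        + 4 * s * hs * (4 * p * hp - 3 * h) - 4 * (p\<^sup>2 - 3 * s\<^sup>2) * hs\<^sup>2)"

end

theory Submission
  imports Defs
begin

text \<open>Let \<open>A = H\<^sub>s + (s/p) H\<^sub>p\<close>, \<open>B = (s/p) H\<^sub>s + H\<^sub>p\<close> and \<open>D = A \<partial>\<^sub>s + B \<partial>\<^sub>p\<close>, the characteristic vector field of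
  the PDE. Differentiating the PDE in \<open>\<lambda>\<close> gives \<open>D H\<^sub>\<lambda> = 0\<close>; differentiating it in \<open>s\<close> and \<open>p\<close> gives
  \<open>D H\<^sub>s = - H\<^sub>s H\<^sub>p / p\<close> and \<open>D H\<^sub>p = s H\<^sub>s H\<^sub>p / p\<^sup>2\<close>. Modulo the PDE,
  \<open>\<tau> = 6 ((H - s H\<^sub>s - p H\<^sub>p)\<^sup>2 + (s\<^sup>2 - p\<^sup>2) H\<^sub>s\<^sup>2)\<close>, so that \<open>D \<tau> = 0\<close> as well. The PDE reads
  \<open>A H\<^sub>s + B H\<^sub>p = 1\<close>, so \<open>D\<close> vanishes nowhere, the \<open>(s, p)\<close>-gradients of \<open>H\<^sub>\<lambda>\<close> and \<open>\<tau>\<close> are parallel,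
  and \<open>H\<^sub>\<lambda>\<close> is locally a function of \<open>\<tau>\<close> and \<open>\<lambda>\<close> where the gradient of \<open>\<tau>\<close> does not vanish.\<close>

section \<open>Symmetry of mixed second derivatives\<close>

text \<open>The second difference of \<open>f\<close> over a parallelogram is symmetric in
  \<open>u\<close> and \<open>v\<close>. Two applications of the mean value theorem, in either
  order, turn it into \<open>h * h\<close> times a value of one or the other mixed derivative near
  \<open>x\<close>; continuity then forces these to agree at \<open>x\<close>.\<close>

lemma mixed_derivatives_eq:
  fixes f :: "'a::real_normed_vector \<Rightarrow> real"
  assumes "open S" "x \<in> S"
    and f: "\<And>y. y \<in> S \<Longrightarrow> (f has_derivative f' y) (at y)"
    and fu: "\<And>y. y \<in> S \<Longrightarrow> ((\<lambda>y. f' y u) has_derivative A y) (at y)"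
    and fv: "\<And>y. y \<in> S \<Longrightarrow> ((\<lambda>y. f' y v) has_derivative B y) (at y)"
    and cont: "continuous_on S (\<lambda>y. A y v)" "continuous_on S (\<lambda>y. B y u)"
  shows "A x v = B x u"
proof -
  \<comment> \<open>The variables \<open>u\<close>, \<open>v\<close>, \<open>A\<close> are bound
    afresh here, so that the same fact serves with \<open>u\<close> and \<open>v\<close> exchanged
    and \<open>B\<close> in place of \<open>A\<close>.\<close>
  have mixed_difference: "\<exists>s t. 0 < s \<and> s < h \<and> 0 < t \<and> t < h \<and>
      f (x + h *\<^sub>R u + h *\<^sub>R v) - f (x + h *\<^sub>R u) - f (x + h *\<^sub>R v) + f x
        = h * h * A (x + s *\<^sub>R u + t *\<^sub>R v) v"
    if h: "h > 0" and inS: "\<And>s t. 0 \<le> s \<Longrightarrow> s \<le> h \<Longrightarrow> 0 \<le> t \<Longrightarrow> t \<le> h \<Longrightarrow> x + s *\<^sub>R u + t *\<^sub>R v \<in> S"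
      and fu: "\<And>y. y \<in> S \<Longrightarrow> ((\<lambda>y. f' y u) has_derivative A y) (at y)"
    for h u v and A :: "'a \<Rightarrow> 'a \<Rightarrow> real"
  proof -
    have d1: "((\<lambda>s. f (x + s *\<^sub>R u + t *\<^sub>R v)) has_real_derivative f' (x + s *\<^sub>R u + t *\<^sub>R v) u) (at s)"
      if "0 \<le> s" "s \<le> h" "0 \<le> t" "t \<le> h" for s t
    proof -
      have "((\<lambda>s. f (x + s *\<^sub>R u + t *\<^sub>R v)) has_derivative
              (\<lambda>k. f' (x + s *\<^sub>R u + t *\<^sub>R v) (k *\<^sub>R u))) (at s)"
        by (rule has_derivative_compose[where f = "\<lambda>s. x + s *\<^sub>R u + t *\<^sub>R v", OF _ f[OF inS[OF that]]])
          (auto intro!: derivative_eq_intros)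
      then show ?thesis
        using linear_cmul[OF has_derivative_linear[OF f[OF inS[OF that]]]]
        by (simp add: has_field_derivative_def mult.commute[of _ "f' _ u"])
    qed
    have d2: "((\<lambda>t. f' (x + s *\<^sub>R u + t *\<^sub>R v) u) has_real_derivative A (x + s *\<^sub>R u + t *\<^sub>R v) v) (at t)"
      if "0 \<le> s" "s \<le> h" "0 \<le> t" "t \<le> h" for s t
    proof -
      have "((\<lambda>t. f' (x + s *\<^sub>R u + t *\<^sub>R v) u) has_derivative
              (\<lambda>k. A (x + s *\<^sub>R u + t *\<^sub>R v) (k *\<^sub>R v))) (at t)"
        by (rule has_derivative_compose[where f = "\<lambda>t. x + s *\<^sub>R u + t *\<^sub>R v", OF _ fu[OF inS[OF that]]])
          (auto intro!: derivative_eq_intros)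
      then show ?thesis
        using linear_cmul[OF has_derivative_linear[OF fu[OF inS[OF that]]]]
        by (simp add: has_field_derivative_def mult.commute[of _ "A _ v"])
    qed
    \<comment> \<open>The summand with factor 0 keeps both terms in the shape treated by
      \<open>d1\<close>.\<close>
    define g where "g s = f (x + s *\<^sub>R u + h *\<^sub>R v) - f (x + s *\<^sub>R u + 0 *\<^sub>R v)" for s
    have "(g has_real_derivative f' (x + s *\<^sub>R u + h *\<^sub>R v) u - f' (x + s *\<^sub>R u + 0 *\<^sub>R v) u) (at s)"
      if "0 \<le> s" "s \<le> h" for s
      unfolding g_def using that h by (intro DERIV_diff d1) auto
    then obtain s where s: "0 < s" "s < h"
      "g h - g 0 = (h - 0) * (f' (x + s *\<^sub>R u + h *\<^sub>R v) u - f' (x + s *\<^sub>R u + 0 *\<^sub>R v) u)"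
      using MVT2[OF h, of g "\<lambda>s. f' (x + s *\<^sub>R u + h *\<^sub>R v) u - f' (x + s *\<^sub>R u + 0 *\<^sub>R v) u"]
      by blast
    moreover obtain t where t: "0 < t" "t < h"
      "f' (x + s *\<^sub>R u + h *\<^sub>R v) u - f' (x + s *\<^sub>R u + 0 *\<^sub>R v) u = (h - 0) * A (x + s *\<^sub>R u + t *\<^sub>R v) v"
      using MVT2[OF h, of "\<lambda>t. f' (x + s *\<^sub>R u + t *\<^sub>R v) u" "\<lambda>t. A (x + s *\<^sub>R u + t *\<^sub>R v) v"]
        d2[of s] s by auto
    ultimately show ?thesis
      by (intro exI[of _ s] exI[of _ t]) (simp add: g_def algebra_simps)
  qed
  show ?thesis
  proof (rule ccontr)
    assume neq: "A x v \<noteq> B x u"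
    define e where "e = dist (A x v) (B x u) / 2"
    have "e > 0" using neq by (simp add: e_def)
    from \<open>open S\<close> \<open>x \<in> S\<close> obtain d0 where d0: "d0 > 0" "ball x d0 \<subseteq> S"
      using openE by blast
    obtain d1 where d1: "d1 > 0" "\<And>y. y \<in> S \<Longrightarrow> dist y x < d1 \<Longrightarrow> dist (A y v) (A x v) < e"
      using cont(1) \<open>x \<in> S\<close> \<open>e > 0\<close> unfolding continuous_on_iff by meson
    obtain d2 where d2: "d2 > 0" "\<And>y. y \<in> S \<Longrightarrow> dist y x < d2 \<Longrightarrow> dist (B y u) (B x u) < e"
      using cont(2) \<open>x \<in> S\<close> \<open>e > 0\<close> unfolding continuous_on_iff by meson
    define d where "d = min d0 (min d1 d2)"
    \<comment> \<open>This size keeps the whole parallelogram within distance \<open>d\<close> of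
      \<open>x\<close>; the 1 covers the case that \<open>u\<close> and \<open>v\<close> are both
      zero.\<close>
    define h where "h = d / (norm u + norm v + 1)"
    have "d > 0" using d0 d1 d2 by (simp add: d_def)
    then have "h > 0" by (simp add: h_def add_nonneg_pos)
    have near: "dist (x + s *\<^sub>R u + t *\<^sub>R v) x < d" if "0 \<le> s" "s \<le> h" "0 \<le> t" "t \<le> h" for s t
    proof -
      have "dist (x + s *\<^sub>R u + t *\<^sub>R v) x = norm (s *\<^sub>R u + t *\<^sub>R v)"
        by (simp add: dist_norm)
      also have "\<dots> \<le> s * norm u + t * norm v"
        using that by (intro order_trans[OF norm_triangle_ineq]) simp
      also have "\<dots> \<le> h * norm u + h * norm v"
        using that by (intro add_mono mult_right_mono) auto
      also have "\<dots> < h * (norm u + norm v + 1)"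
        using \<open>h > 0\<close> by (simp add: algebra_simps)
      also have "\<dots> = d"
        unfolding h_def using norm_ge_zero[of u] norm_ge_zero[of v] by (simp add: add_nonneg_eq_0_iff)
      finally show ?thesis .
    qed
    have inS: "x + s *\<^sub>R u + t *\<^sub>R v \<in> S" if "0 \<le> s" "s \<le> h" "0 \<le> t" "t \<le> h" for s t
      using near[OF that] d0(2) by (auto simp: d_def dist_commute)
    obtain s t where st: "0 < s" "s < h" "0 < t" "t < h"
      "f (x + h *\<^sub>R u + h *\<^sub>R v) - f (x + h *\<^sub>R u) - f (x + h *\<^sub>R v) + f x
        = h * h * A (x + s *\<^sub>R u + t *\<^sub>R v) v"
      using mixed_difference[OF \<open>h > 0\<close> inS fu] by blast
    have inS': "x + s *\<^sub>R v + t *\<^sub>R u \<in> S" if "0 \<le> s" "s \<le> h" "0 \<le> t" "t \<le> h" for s t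
      using inS[of t s] that by (simp add: algebra_simps)
    obtain s' t' where st': "0 < s'" "s' < h" "0 < t'" "t' < h"
      "f (x + h *\<^sub>R v + h *\<^sub>R u) - f (x + h *\<^sub>R v) - f (x + h *\<^sub>R u) + f x
        = h * h * B (x + s' *\<^sub>R v + t' *\<^sub>R u) u"
      using mixed_difference[OF \<open>h > 0\<close> inS' fv] by blast
    have "h * h * A (x + s *\<^sub>R u + t *\<^sub>R v) v = h * h * B (x + t' *\<^sub>R u + s' *\<^sub>R v) u"
      using st(5) st'(5) by (simp add: algebra_simps)
    then have "A (x + s *\<^sub>R u + t *\<^sub>R v) v = B (x + t' *\<^sub>R u + s' *\<^sub>R v) u"
      using \<open>h > 0\<close> by simp
    moreover have "dist (A (x + s *\<^sub>R u + t *\<^sub>R v) v) (A x v) < e"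
      using st near[of s t] inS[of s t] by (intro d1(2)) (auto simp: d_def)
    moreover have "dist (B (x + t' *\<^sub>R u + s' *\<^sub>R v) u) (B x u) < e"
      using st' near[of t' s'] inS[of t' s'] by (intro d2(2)) (auto simp: d_def)
    ultimately have "dist (A x v) (B x u) < e + e"
      using dist_triangle3[of "A x v" "B x u" "A (x + s *\<^sub>R u + t *\<^sub>R v) v"] by simp
    then show False by (simp add: e_def)
  qed
qed

section \<open>Functional dependence from parallel gradients\<close>

text \<open>Only points that differ by a vector of the plane spanned by \<open>u\<close> and
  \<open>v\<close> are compared. With \<open>u\<close>, \<open>v\<close> the directions of
  \<open>s\<close> and \<open>p\<close>, this holds \<lambda> fixed, which is why the resulting
  function may depend on \<lambda>.\<close>

lemma functional_dependence:
  fixes K T :: "'a::euclidean_space \<Rightarrow> real"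
  assumes "open U" "x0 \<in> U"
    and K: "\<And>x. x \<in> U \<Longrightarrow> (K has_derivative K' x) (at x)"
    and T: "\<And>x. x \<in> U \<Longrightarrow> (T has_derivative T' x) (at x)"
    and cont: "\<And>w. continuous_on U (\<lambda>x. T' x w)"
    and parallel: "\<And>x. x \<in> U \<Longrightarrow> K' x u * T' x v = K' x v * T' x u"
    and nz: "T' x0 v \<noteq> 0"
    and uv: "v \<bullet> v = 1" "u \<bullet> v = 0"
  obtains N where "open N" "x0 \<in> N" "N \<subseteq> U"
    "\<And>x y \<alpha> \<beta>. x \<in> N \<Longrightarrow> y \<in> N \<Longrightarrow> y - x = \<alpha> *\<^sub>R u + \<beta> *\<^sub>R v \<Longrightarrow> T x = T y \<Longrightarrow> K x = K y"
proof -
  \<comment> \<open>\<open>\<Phi>\<close> replaces the \<open>v\<close>-coordinate by \<open>T\<close>, so two points of the plane spanned by \<open>u, v\<close> with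
    equal \<open>T\<close> are mapped to a line of direction \<open>u\<close>, along which \<open>K \<circ> \<Phi>\<^sup>-\<^sup>1\<close> has derivative zero.\<close>
  define \<Phi> where "\<Phi> x = x + (T x - x \<bullet> v) *\<^sub>R v" for x
  define \<Phi>' where "\<Phi>' x = Blinfun (\<lambda>w. w + (T' x w - w \<bullet> v) *\<^sub>R v)" for x
  have bl: "bounded_linear (\<lambda>w. w + (T' x w - w \<bullet> v) *\<^sub>R v)" if "x \<in> U" for x
    using has_derivative_bounded_linear[OF T[OF that]]
    by (intro bounded_linear_intros bounded_linear_scaleR_const) auto
  have app: "blinfun_apply (\<Phi>' x) w = w + (T' x w - w \<bullet> v) *\<^sub>R v" if "x \<in> U" for x w
    unfolding \<Phi>'_def by (simp add: bounded_linear_Blinfun_apply[OF bl[OF that]])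
  have der\<Phi>: "(\<Phi> has_derivative blinfun_apply (\<Phi>' x)) (at x)" if "x \<in> U" for x
    unfolding \<Phi>_def app[OF that, abs_def]
    by (auto intro!: derivative_eq_intros T[OF that] simp: app[OF that])
  have cont\<Phi>': "continuous_on U \<Phi>'"
  proof (rule continuous_on_blinfun_componentwise)
    fix i :: 'a assume "i \<in> Basis"
    have "continuous_on U (\<lambda>x. i + (T' x i - i \<bullet> v) *\<^sub>R v)"
      by (intro continuous_intros cont)
    then show "continuous_on U (\<lambda>x. blinfun_apply (\<Phi>' x) i)"
      by (simp add: app cong: continuous_on_cong)
  qed
  \<comment> \<open>The inverse of \<open>\<Phi>' x0\<close>: a preimage of \<open>w\<close> has the
    form \<open>w + c *\<^sub>R v\<close>, and comparing components along \<open>v\<close> gives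
    \<open>T' x0 w + c * T' x0 v = w \<bullet> v\<close>. The division is where \<open>nz\<close>
    enters.\<close>
  define J where "J = Blinfun (\<lambda>w. w + ((w \<bullet> v - T' x0 w) / T' x0 v) *\<^sub>R v)"
  have "bounded_linear (\<lambda>w. w + ((w \<bullet> v - T' x0 w) / T' x0 v) *\<^sub>R v)"
    using has_derivative_bounded_linear[OF T[OF \<open>x0 \<in> U\<close>]]
    by (intro bounded_linear_intros bounded_linear_scaleR_const bounded_linear_divide[THEN bounded_linear_compose]) auto
  then have J: "blinfun_apply J w = w + ((w \<bullet> v - T' x0 w) / T' x0 v) *\<^sub>R v" for w
    unfolding J_def by (simp add: bounded_linear_Blinfun_apply)
  have lin: "linear (T' x)" "linear (K' x)" if "x \<in> U" for x
    using T[OF that] K[OF that] by (auto intro: has_derivative_linear)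
  have "J o\<^sub>L \<Phi>' x0 = id_blinfun"
    using nz uv lin(1)[OF \<open>x0 \<in> U\<close>] \<open>x0 \<in> U\<close>
    by (intro blinfun_eqI)
      (simp add: J app linear_add linear_cmul inner_add_left algebra_simps divide_simps
        flip: scaleR_add_left scaleR_diff_left)
  then obtain U' V g g' where inv: "open U'" "U' \<subseteq> U" "x0 \<in> U'" "open V" "\<Phi> x0 \<in> V"
      "homeomorphism U' V \<Phi> g"
      "\<And>y. y \<in> V \<Longrightarrow> (g has_derivative g' y) (at y)"
      "\<And>y. y \<in> V \<Longrightarrow> g' y = inv (blinfun_apply (\<Phi>' (g y)))"
      "\<And>y. y \<in> V \<Longrightarrow> bij (blinfun_apply (\<Phi>' (g y)))"
    using inverse_function_theorem[OF \<open>open U\<close> der\<Phi> cont\<Phi>' \<open>x0 \<in> U\<close>] by blast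
  obtain r where r: "r > 0" "ball (\<Phi> x0) r \<subseteq> V"
    using inv(4,5) openE by blast
  \<comment> \<open>Convexity of the ball keeps the segment between the images of two points of
    \<open>N\<close> inside \<open>V\<close>, where \<open>g\<close> is differentiable.\<close>
  define N where "N = U' \<inter> \<Phi> -` ball (\<Phi> x0) r"
  show ?thesis
  proof (rule that)
    show "open N"
      unfolding N_def using inv(1,6) by (auto intro: continuous_open_preimage simp: homeomorphism_def)
    show "x0 \<in> N" "N \<subseteq> U" using inv r by (auto simp: N_def)
    fix x y \<alpha> \<beta>
    assume xy: "x \<in> N" "y \<in> N" "y - x = \<alpha> *\<^sub>R u + \<beta> *\<^sub>R v" "T x = T y"
    have y: "y = x + \<alpha> *\<^sub>R u + \<beta> *\<^sub>R v" using xy(3) by (simp add: algebra_simps)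
    have \<Phi>y: "\<Phi> y = \<Phi> x + \<alpha> *\<^sub>R u"
      unfolding \<Phi>_def xy(4)[symmetric] using uv
      by (simp add: y inner_add_left algebra_simps)
    define \<gamma> where "\<gamma> = (\<lambda>t. \<Phi> x + t *\<^sub>R \<alpha> *\<^sub>R u)"
    have \<gamma>V: "\<gamma> t \<in> V" if "t \<in> {0..1}" for t
    proof -
      have "\<gamma> t = (1 - t) *\<^sub>R \<Phi> x + t *\<^sub>R \<Phi> y" by (simp add: \<gamma>_def \<Phi>y algebra_simps)
      also have "\<dots> \<in> ball (\<Phi> x0) r"
        using xy(1,2) that by (intro convexD) (auto simp: N_def)
      finally show ?thesis using r by blast
    qed
    have "((\<lambda>t. K (g (\<gamma> t))) has_derivative (\<lambda>h. 0)) (at t within {0..1})" if t: "t \<in> {0..1}" for t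
    proof -
      let ?z = "g (\<gamma> t)"
      have zU: "?z \<in> U" using \<gamma>V[OF t] inv(2,6) by (auto simp: homeomorphism_def)
      define w where "w = g' (\<gamma> t) (\<alpha> *\<^sub>R u)"
      have d: "((\<lambda>t. K (g (\<gamma> t))) has_derivative (\<lambda>h. K' ?z (g' (\<gamma> t) (h *\<^sub>R \<alpha> *\<^sub>R u)))) (at t)"
        by (rule has_derivative_compose[where f = "\<lambda>t. g (\<gamma> t)", OF
              has_derivative_compose[where f = \<gamma>, OF _ inv(7)[OF \<gamma>V[OF t]]] K[OF zU]])
          (auto simp: \<gamma>_def intro!: derivative_eq_intros)
      have "blinfun_apply (\<Phi>' ?z) w = \<alpha> *\<^sub>R u"
        unfolding w_def using inv(8,9)[OF \<gamma>V[OF t]] by (simp add: bij_is_surj surj_f_inv_f)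
      \<comment> \<open>The \<open>v\<close>-component of this equation says that \<open>w\<close>
        is tangent to the level set of \<open>T\<close>; the equation then also places
        \<open>w\<close> in the plane of \<open>u\<close> and \<open>v\<close>.\<close>
      then have w: "w + (T' ?z w - w \<bullet> v) *\<^sub>R v = \<alpha> *\<^sub>R u" using app[OF zU] by simp
      then have "(w + (T' ?z w - w \<bullet> v) *\<^sub>R v) \<bullet> v = 0" using uv by simp
      then have Tw: "T' ?z w = 0" using uv by (simp add: inner_add_left)
      obtain c where c: "w = \<alpha> *\<^sub>R u + c *\<^sub>R v"
        using w Tw by (metis add_diff_cancel_right' diff_conv_add_uminus scaleR_minus_left)
      have "T' ?z v \<noteq> 0"
      proof
        assume "T' ?z v = 0"
        then have "blinfun_apply (\<Phi>' ?z) v = blinfun_apply (\<Phi>' ?z) 0"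
          using app[OF zU] uv by simp
        then have "v = 0"
          using inv(9)[OF \<gamma>V[OF t]] by (metis bij_is_inj injD)
        then show False using uv by simp
      qed
      moreover have "\<alpha> * T' ?z u + c * T' ?z v = 0"
        using Tw lin(1)[OF zU] by (simp add: c linear_add linear_cmul)
      \<comment> \<open>By \<open>parallel\<close>, the left side equals \<open>K' ?z v\<close>
        times the vanishing expression above.\<close>
      then have "T' ?z v * (\<alpha> * K' ?z u + c * K' ?z v) = 0"
        using parallel[OF zU] by algebra
      ultimately have "\<alpha> * K' ?z u + c * K' ?z v = 0"
        by (metis mult_eq_0_iff)
      then have "K' ?z w = 0"
        using lin(2)[OF zU] by (simp add: c linear_add linear_cmul)
      moreover have "K' ?z (g' (\<gamma> t) (h *\<^sub>R \<alpha> *\<^sub>R u)) = h * K' ?z w" for h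
        using lin(2)[OF zU] has_derivative_linear[OF inv(7)[OF \<gamma>V[OF t]]] by (simp add: w_def linear_cmul)
      ultimately show ?thesis using d by (simp add: has_derivative_at_withinI)
    qed
    then have "K (g (\<gamma> 0)) = K (g (\<gamma> 1))"
      by (intro has_derivative_zero_unique[of "{0..1}" "\<lambda>t. K (g (\<gamma> t))"]) auto
    moreover have "g (\<gamma> 0) = x" "g (\<gamma> 1) = y"
      using xy(1,2) inv(6) by (auto simp: \<gamma>_def N_def homeomorphism_def simp flip: \<Phi>y)
    ultimately show "K x = K y" by simp
  qed
qed

section \<open>Partial derivatives in \<open>(s, p, \<lambda>)\<close> and their regularity\<close>

lemma partials_eq:
  assumes "(F has_derivative F') (at x)"
  shows "ds F x = F' (1, 0, 0)" "dp F x = F' (0, 1, 0)" "dlam F x = F' (0, 0, 1)"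
proof -
  obtain s p l where x: "x = (s, p, l)" by (cases x)
  note F = assms[unfolded x]
  have lin: "(\<lambda>h. F' (h *\<^sub>R w)) = (*) (F' w)" for w
    using linear_cmul[OF has_derivative_linear[OF assms]] by (simp add: fun_eq_iff mult.commute)
  have "((\<lambda>t. F (t, p, l)) has_derivative (\<lambda>h. F' (h, 0, 0))) (at s)"
       "((\<lambda>t. F (s, t, l)) has_derivative (\<lambda>h. F' (0, h, 0))) (at p)"
       "((\<lambda>t. F (s, p, t)) has_derivative (\<lambda>h. F' (0, 0, h))) (at l)"
    by (rule has_derivative_compose[where f = "\<lambda>t. (t, p, l)", OF _ F]
          has_derivative_compose[where f = "\<lambda>t. (s, t, l)", OF _ F]
          has_derivative_compose[where f = "\<lambda>t. (s, p, t)", OF _ F],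
        auto intro!: derivative_eq_intros simp: zero_prod_def)+
  then show "ds F x = F' (1, 0, 0)" "dp F x = F' (0, 1, 0)" "dlam F x = F' (0, 0, 1)"
    using lin[of "(1, 0, 0)"] lin[of "(0, 1, 0)"] lin[of "(0, 0, 1)"]
    by (simp_all add: x ds_def dp_def dlam_def has_field_derivative_def DERIV_imp_deriv)
qed

text \<open>Built from the partials instead of \<open>frechet_derivative\<close>, so that evaluation
  at a coordinate vector simplifies to a partial derivative. It is the Frechet derivative wherever
  \<open>F\<close> is differentiable.\<close>

definition total_derivative ::
    "(real \<times> real \<times> real \<Rightarrow> real) \<Rightarrow> real \<times> real \<times> real \<Rightarrow> real \<times> real \<times> real \<Rightarrow> real" where
  "total_derivative F x = (\<lambda>w. ds F x * fst w + dp F x * fst (snd w) + dlam F x * snd (snd w))"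

lemma has_derivative_total_derivative:
  assumes "F differentiable (at x)"
  shows "(F has_derivative total_derivative F x) (at x)"
proof -
  obtain F' where F': "(F has_derivative F') (at x)"
    using assms by (auto simp: differentiable_def)
  have "F' (a, b, c) = ds F x * a + dp F x * b + dlam F x * c" for a b c
  proof -
    have "F' (a, b, c) = F' (a *\<^sub>R (1, 0, 0) + b *\<^sub>R (0, 1, 0) + c *\<^sub>R (0, 0, 1))" by simp
    also have "\<dots> = ds F x * a + dp F x * b + dlam F x * c"
      unfolding partials_eq[OF F'] using has_derivative_linear[OF F']
      by (simp only: linear_add linear_cmul) simp
    finally show ?thesis .
  qed
  then have "F' = total_derivative F x" by (auto simp: total_derivative_def)
  then show ?thesis using F' by simp
qed

text \<open>On an open set, derivatives depend only on the values there. This carries regularity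
  from the directional derivatives in \<open>Ck_on\<close> to \<open>ds\<close>, \<open>dp\<close>
  and \<open>dlam\<close>, which are known to agree with them only on \<open>S\<close>.\<close>

lemma Ck_on_cong:
  assumes "open S" "\<And>x. x \<in> S \<Longrightarrow> f x = g x" "Ck_on n f S"
  shows "Ck_on n g S"
  using assms(2,3)
proof (induction n arbitrary: f g)
  case 0
  then show ?case by (simp cong: continuous_on_cong)
next
  case (Suc n)
  have "g differentiable (at x)" if "x \<in> S" for x
    using Suc.prems that \<open>open S\<close> 
    by (metis Ck_on.simps(2) differentiable_def has_derivative_transform_within_open)
  moreover have "Ck_on n (\<lambda>x. frechet_derivative g (at x) v) S" for v
  proof (rule Suc.IH)
    show "Ck_on n (\<lambda>x. frechet_derivative f (at x) v) S" using Suc.prems by simp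
    show "frechet_derivative f (at x) v = frechet_derivative g (at x) v" if "x \<in> S" for x
      using frechet_derivative_transform_within_open[of f x S g] Suc.prems that \<open>open S\<close> by simp
  qed
  ultimately show ?case by simp
qed

lemma Ck_on_partials:
  assumes "open S" "Ck_on (Suc n) F S"
  shows "Ck_on n (ds F) S" "Ck_on n (dp F) S" "Ck_on n (dlam F) S"
proof -
  have "(F has_derivative frechet_derivative F (at x)) (at x)" if "x \<in> S" for x
    using assms(2) that by (simp add: frechet_derivative_works)
  note eq = partials_eq[OF this]
  show "Ck_on n (ds F) S" "Ck_on n (dp F) S" "Ck_on n (dlam F) S"
    using assms by (auto intro: Ck_on_cong[OF \<open>open S\<close> eq(1)[symmetric]]
       Ck_on_cong[OF \<open>open S\<close> eq(2)[symmetric]] Ck_on_cong[OF \<open>open S\<close> eq(3)[symmetric]])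
qed

lemma partials_commute:
  assumes "open S" "Ck_on (Suc (Suc 0)) F S" "x \<in> S"
  shows "dp (ds F) x = ds (dp F) x" "dlam (ds F) x = ds (dlam F) x" "dlam (dp F) x = dp (dlam F) x"
proof -
  note C1 = Ck_on_partials[OF assms(1,2)]
  \<comment> \<open>Continuity of all nine second-order partials.\<close>
  note C0 = C1[THEN Ck_on_partials(1)[OF \<open>open S\<close>]] C1[THEN Ck_on_partials(2)[OF \<open>open S\<close>]]
    C1[THEN Ck_on_partials(3)[OF \<open>open S\<close>]]
  have F: "(F has_derivative total_derivative F y) (at y)"
    and G: "(ds F has_derivative total_derivative (ds F) y) (at y)"
      "(dp F has_derivative total_derivative (dp F) y) (at y)"
      "(dlam F has_derivative total_derivative (dlam F) y) (at y)" if "y \<in> S" for y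
    using that assms(2) C1 by (auto intro!: has_derivative_total_derivative)
  note mixed = mixed_derivatives_eq[OF \<open>open S\<close> \<open>x \<in> S\<close> F]
  show "dp (ds F) x = ds (dp F) x"
    using mixed[of "(1, 0, 0)" "total_derivative (ds F)" "(0, 1, 0)" "total_derivative (dp F)"] G C0
    by (simp add: total_derivative_def)
  show "dlam (ds F) x = ds (dlam F) x"
    using mixed[of "(1, 0, 0)" "total_derivative (ds F)" "(0, 0, 1)" "total_derivative (dlam F)"] G C0
    by (simp add: total_derivative_def)
  show "dlam (dp F) x = dp (dlam F) x"
    using mixed[of "(0, 1, 0)" "total_derivative (dp F)" "(0, 0, 1)" "total_derivative (dlam F)"] G C0
    by (simp add: total_derivative_def)
qed

theorem mainTheorem4:
  fixes H :: "real \<times> real \<times> real \<Rightarrow> real"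
    and U :: "(real \<times> real \<times> real) set"
    and s0 p0 l0 :: real
  assumes "open U"
    and "U \<subseteq> {(s, p, l). s > p \<and> p > 0}"
    and "smooth_on H U"
    and "lorentz_invariant_on H U"
    and "(s0, p0, l0) \<in> U"
    and "(ds (tau H) (s0, p0, l0), dp (tau H) (s0, p0, l0)) \<noteq> (0, 0)"
  shows "\<exists>N (f :: real \<Rightarrow> real \<Rightarrow> real). open N \<and> (s0, p0, l0) \<in> N \<and> N \<subseteq> U \<and>
           (\<forall>(s, p, l)\<in>N. dlam H (s, p, l) = f (tau H (s, p, l)) l)"
proof -
  have C2: "Ck_on (Suc (Suc 0)) H U"
    using assms(3) unfolding smooth_on_def by blast
  note C1 = Ck_on_partials[OF \<open>open U\<close> C2]
  note C0 = C1[THEN Ck_on_partials(1)[OF \<open>open U\<close>]] C1[THEN Ck_on_partials(2)[OF \<open>open U\<close>]]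
    C1[THEN Ck_on_partials(3)[OF \<open>open U\<close>]]
  note comm = partials_commute[OF \<open>open U\<close> C2]
  have p_pos: "fst (snd x) > 0" if "x \<in> U" for x
    using assms(2) that by auto
  have dH: "(H has_derivative total_derivative H x) (at x)"
    and da: "(ds H has_derivative total_derivative (ds H) x) (at x)"
    and db: "(dp H has_derivative total_derivative (dp H) x) (at x)"
    and dK: "(dlam H has_derivative total_derivative (dlam H) x) (at x)" if "x \<in> U" for x
    using that C2 C1 by (auto intro!: has_derivative_total_derivative)
  have cont: "continuous_on U H" "continuous_on U (ds H)" "continuous_on U (dp H)" "continuous_on U (dlam H)"
    by (rule has_derivative_continuous_on[OF has_derivative_at_withinI]; rule dH da db dK; assumption)+

  \<comment> \<open>The PDE, multiplied by \<open>p\<close>, and its derivatives\<close>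
  have pde: "fst (snd x) * (ds H x)\<^sup>2 + 2 * fst x * ds H x * dp H x + fst (snd x) * (dp H x)\<^sup>2 = fst (snd x)"
    if "x \<in> U" for x
  proof -
    obtain s p l where x: "x = (s, p, l)" by (cases x)
    have "(ds H x)\<^sup>2 + 2 * s / p * ds H x * dp H x + (dp H x)\<^sup>2 = 1"
      using assms(4) that by (auto simp: lorentz_invariant_on_def x)
    then show ?thesis
      using p_pos[OF that] by (simp add: x field_simps)
  qed
  \<comment> \<open>The polynomial form of the PDE is differentiated in an arbitrary direction
    \<open>w\<close>; the three coordinate directions are substituted later.\<close>
  have dpde: "fst (snd w) * (ds H x)\<^sup>2 + fst (snd x) * (2 * ds H x * total_derivative (ds H) x w)
      + 2 * fst w * ds H x * dp H x
      + 2 * fst x * (total_derivative (ds H) x w * dp H x + ds H x * total_derivative (dp H) x w)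
      + fst (snd w) * (dp H x)\<^sup>2 + fst (snd x) * (2 * dp H x * total_derivative (dp H) x w) = fst (snd w)"
    (is "?L w = _") if "x \<in> U" for x w
  proof -
    have "((\<lambda>x. fst (snd x) * (ds H x)\<^sup>2 + 2 * fst x * ds H x * dp H x + fst (snd x) * (dp H x)\<^sup>2)
        has_derivative ?L) (at x)"
      by (auto intro!: derivative_eq_intros da[OF that] db[OF that] simp: algebra_simps)
    from has_derivative_transform_within_open[OF this \<open>open U\<close> that pde]
    have "((\<lambda>x. fst (snd x)) has_derivative ?L) (at x)" by simp
    moreover have "((\<lambda>x::real \<times> real \<times> real. fst (snd x)) has_derivative (\<lambda>w. fst (snd w))) (at x)"
      by (auto intro!: derivative_eq_intros)
    ultimately have "?L = (\<lambda>w. fst (snd w))" by (rule has_derivative_unique)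
    then show ?thesis by metis
  qed

  \<comment> \<open>The energy-momentum scalar and its derivative\<close>
  have tau_eq: "tau H x = 6 * ((H x - fst x * ds H x - fst (snd x) * dp H x)\<^sup>2
      + ((fst x)\<^sup>2 - (fst (snd x))\<^sup>2) * (ds H x)\<^sup>2)" if "x \<in> U" for x
  proof -
    obtain s p l where x: "x = (s, p, l)" by (cases x)
    \<comment> \<open>The two expressions for \<open>tau H\<close> differ by exactly
      \<open>2 * p\<close> times the defect of the PDE in its form multiplied by
      \<open>p\<close>.\<close>
    have "2 * p * (p * (ds H x)\<^sup>2 + 2 * s * ds H x * dp H x + p * (dp H x)\<^sup>2) = 2 * p * p"
      using pde[OF that] x by simp
    then show ?thesis
      by (simp add: tau_def x Let_def power2_eq_square algebra_simps)
  qed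
  define T' where "T' x w =
      12 * (H x - fst x * ds H x - fst (snd x) * dp H x)
        * (total_derivative H x w - fst w * ds H x - fst x * total_derivative (ds H) x w
            - fst (snd w) * dp H x - fst (snd x) * total_derivative (dp H) x w)
      + 12 * (fst x * fst w - fst (snd x) * fst (snd w)) * (ds H x)\<^sup>2
      + 12 * ((fst x)\<^sup>2 - (fst (snd x))\<^sup>2) * ds H x * total_derivative (ds H) x w" for x w
  have dtau: "(tau H has_derivative T' x) (at x)" if "x \<in> U" for x
  proof (rule has_derivative_transform_within_open[OF _ \<open>open U\<close> that tau_eq[symmetric]])
    show "((\<lambda>x. 6 * ((H x - fst x * ds H x - fst (snd x) * dp H x)\<^sup>2
        + ((fst x)\<^sup>2 - (fst (snd x))\<^sup>2) * (ds H x)\<^sup>2)) has_derivative T' x) (at x)"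
      by (rule has_derivative_eq_rhs, (rule derivative_intros dH da db that)+, rule ext)
        (simp add: T'_def algebra_simps power2_eq_square)
  qed
  have contT': "continuous_on U (\<lambda>x. T' x w)" for w
    unfolding T'_def total_derivative_def using cont C0 by (intro continuous_intros) auto

  \<comment> \<open>Constancy along characteristics and parallel gradients\<close>
  have parallel: "ds (dlam H) x * T' x (0, 1, 0) = dp (dlam H) x * T' x (1, 0, 0)" if "x \<in> U" for x
  proof -
    obtain s p l where x: "x = (s, p, l)" by (cases x)
    \<comment> \<open>These are \<open>p\<close> times the coefficients of the characteristic vector field.\<close>
    define A where "A = p * ds H x + s * dp H x"
    define B where "B = s * ds H x + p * dp H x"
    have p: "p > 0" using p_pos[OF that] x by simp
    have AB: "A * ds H x + B * dp H x = p"
      using pde[OF that] by (simp add: A_def B_def x power2_eq_square algebra_simps)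
    have K: "A * ds (dlam H) x + B * dp (dlam H) x = 0"
      using dpde[OF that, of "(0, 0, 1)"] comm[OF that]
      by (simp add: A_def B_def x total_derivative_def algebra_simps)
    have a: "A * ds (ds H) x + B * dp (ds H) x = - ds H x * dp H x"
      using dpde[OF that, of "(1, 0, 0)"] comm[OF that]
      by (simp add: A_def B_def x total_derivative_def algebra_simps)
    \<comment> \<open>Differentiation in \<open>p\<close> leaves the term
      \<open>(ds H x)\<^sup>2 + (dp H x)\<^sup>2 - 1\<close>. The PDE equates \<open>p\<close> times
      it with \<open>- 2 * s * ds H x * dp H x\<close>, hence the factor \<open>p\<close> on the
      left.\<close>
    have b: "p * (A * ds (dp H) x + B * dp (dp H) x) = s * ds H x * dp H x"
    proof -
      have "p * ((ds H x)\<^sup>2 + (dp H x)\<^sup>2 + 2 * A * dp (ds H) x + 2 * B * dp (dp H) x) = p"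
        using dpde[OF that, of "(0, 1, 0)"]
        by (simp add: A_def B_def x total_derivative_def algebra_simps)
      moreover have "p * (ds H x)\<^sup>2 + 2 * s * ds H x * dp H x + p * (dp H x)\<^sup>2 = p"
        using pde[OF that] x by simp
      ultimately show ?thesis using comm(1)[OF that] by (simp add: algebra_simps)
    qed
    \<comment> \<open>First derivatives of \<open>H\<close> cancel in the derivative of
      \<open>H - s H_s - p H_p\<close>. By \<open>a\<close> and \<open>b\<close> its remaining terms
      cancel along the characteristic, and so do the two contributions of
      \<open>(s\<^sup>2 - p\<^sup>2) H_s\<^sup>2\<close>.\<close>
    have T: "A * T' x (1, 0, 0) + B * T' x (0, 1, 0) = 0"
    proof -
      have "s * A - p * B = (s\<^sup>2 - p\<^sup>2) * dp H x"
        by (simp add: A_def B_def power2_eq_square algebra_simps)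
      moreover have "A * T' x (1, 0, 0) + B * T' x (0, 1, 0) =
          12 * (H x - s * ds H x - p * dp H x)
            * (- s * (A * ds (ds H) x + B * dp (ds H) x) - p * (A * ds (dp H) x + B * dp (dp H) x))
          + 12 * (s * A - p * B) * (ds H x)\<^sup>2
          + 12 * (s\<^sup>2 - p\<^sup>2) * ds H x * (A * ds (ds H) x + B * dp (ds H) x)"
        unfolding T'_def total_derivative_def by (simp add: x algebra_simps)
      ultimately show ?thesis unfolding a b by (simp add: power2_eq_square)
    qed
    \<comment> \<open>Cramer's rule expresses both \<open>A\<close> and \<open>B\<close> times the
      determinant of the two gradients through the vanishing derivatives \<open>K\<close> and
      \<open>T\<close>. Weighting by \<open>ds H x\<close> and \<open>dp H x\<close> and using
      \<open>AB\<close> avoids a case split on which of \<open>A\<close>, \<open>B\<close> is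
      nonzero.\<close>
    have "p * (ds (dlam H) x * T' x (0, 1, 0) - dp (dlam H) x * T' x (1, 0, 0))
      = ds H x * (T' x (0, 1, 0) * (A * ds (dlam H) x + B * dp (dlam H) x)
                  - dp (dlam H) x * (A * T' x (1, 0, 0) + B * T' x (0, 1, 0)))
        + dp H x * (ds (dlam H) x * (A * T' x (1, 0, 0) + B * T' x (0, 1, 0))
                  - T' x (1, 0, 0) * (A * ds (dlam H) x + B * dp (dlam H) x))"
      unfolding AB[symmetric] by (simp add: algebra_simps)
    then show ?thesis using p K T by simp
  qed
  then have par: "total_derivative (dlam H) x (1, 0, 0) * T' x (0, 1, 0)
      = total_derivative (dlam H) x (0, 1, 0) * T' x (1, 0, 0)" if "x \<in> U" for x
    using that by (simp add: total_derivative_def)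

  \<comment> \<open>From parallel gradients to a function of \<tau> and \<lambda>\<close>
  obtain N where N: "open N" "(s0, p0, l0) \<in> N" "N \<subseteq> U"
    "\<And>s p s' p' l. (s, p, l) \<in> N \<Longrightarrow> (s', p', l) \<in> N \<Longrightarrow> tau H (s, p, l) = tau H (s', p', l)
      \<Longrightarrow> dlam H (s, p, l) = dlam H (s', p', l)"
  \<comment> \<open>The direction \<open>v\<close> to be replaced by \<open>tau H\<close> must be
    one in which its derivative is nonzero; \<open>u\<close> is the other of the two
    directions.\<close>
  proof (cases "dp (tau H) (s0, p0, l0) = 0")
    case False
    then have nz: "T' (s0, p0, l0) (0, 1, 0) \<noteq> 0"
      using partials_eq[OF dtau[OF assms(5)]] by simp
    obtain N where N: "open N" "(s0, p0, l0) \<in> N" "N \<subseteq> U"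
        "\<And>x y \<alpha> \<beta>. x \<in> N \<Longrightarrow> y \<in> N \<Longrightarrow> y - x = \<alpha> *\<^sub>R (1, 0, 0) + \<beta> *\<^sub>R (0, 1, 0)
          \<Longrightarrow> tau H x = tau H y \<Longrightarrow> dlam H x = dlam H y"
      by (rule functional_dependence[OF \<open>open U\<close> assms(5) dK dtau contT' par nz]) simp_all
    show thesis
    proof (rule that[OF N(1-3)])
      fix s p s' p' l
      assume "(s, p, l) \<in> N" "(s', p', l) \<in> N" "tau H (s, p, l) = tau H (s', p', l)"
      then show "dlam H (s, p, l) = dlam H (s', p', l)"
        using N(4)[of "(s, p, l)" "(s', p', l)" "s' - s" "p' - p"] by simp
    qed
  next
    case True
    then have nz: "T' (s0, p0, l0) (1, 0, 0) \<noteq> 0"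
      using partials_eq[OF dtau[OF assms(5)]] assms(6) by simp
    obtain N where N: "open N" "(s0, p0, l0) \<in> N" "N \<subseteq> U"
        "\<And>x y \<alpha> \<beta>. x \<in> N \<Longrightarrow> y \<in> N \<Longrightarrow> y - x = \<alpha> *\<^sub>R (0, 1, 0) + \<beta> *\<^sub>R (1, 0, 0)
          \<Longrightarrow> tau H x = tau H y \<Longrightarrow> dlam H x = dlam H y"
      by (rule functional_dependence[OF \<open>open U\<close> assms(5) dK dtau contT' par[symmetric] nz]) simp_all
    show thesis
    proof (rule that[OF N(1-3)])
      fix s p s' p' l
      assume "(s, p, l) \<in> N" "(s', p', l) \<in> N" "tau H (s, p, l) = tau H (s', p', l)"
      then show "dlam H (s, p, l) = dlam H (s', p', l)"
        using N(4)[of "(s, p, l)" "(s', p', l)" "p' - p" "s' - s"] by simp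
    qed
  qed
  \<comment> \<open>The choice of the point is immaterial by \<open>N(4)\<close>; where no such
    point exists, the value of \<open>f\<close> is arbitrary.\<close>
  define f where "f t l = dlam H (SOME x. x \<in> N \<and> tau H x = t \<and> snd (snd x) = l)" for t l
  have "dlam H (s, p, l) = f (tau H (s, p, l)) l" if "(s, p, l) \<in> N" for s p l
  proof -
    define y where "y = (SOME x. x \<in> N \<and> tau H x = tau H (s, p, l) \<and> snd (snd x) = l)"
    have "y \<in> N \<and> tau H y = tau H (s, p, l) \<and> snd (snd y) = l"
      unfolding y_def by (rule someI[of _ "(s, p, l)"]) (simp add: that)
    moreover obtain s' p' l' where "y = (s', p', l')" by (cases y)
    ultimately have "dlam H (s, p, l) = dlam H y"
      using N(4)[OF that, of s' p'] by auto
    then show ?thesis by (simp add: f_def y_def)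
  qed
  with N(1-3) show ?thesis by (intro exI[of _ N] exI[of _ f]) auto
qed

end
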